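(* Let $\mathbb F\in\{\mathbb R,\mathbb C\}$, let $X$ be a Banach space over $\mathbb F$, and let $L$ be an extremally disconnected compact Hausdorff space such that $\operatorname{dens}(X)<\kappa(L)$. Then the pair $(X, C(L))$ has the Bishop--Phelps--Bollobás property.
   Context: $C(L)=C(L,\mathbb F)$ is the Banach space of continuous $\mathbb F$-valued functions on $L$ with the supremum norm. A compact Hausdorff space is extremally disconnected if the closure of every open subset is open. $\operatorname{dens}(X)$ is the density character of $X$: the least cardinality of a norm-dense subset of $X$. The Baire number $\kappa(L)$ of a topological space $L$ is the least cardinal $\kappa$ for which there exists a family of $\kappa$ dense open subsets of $L$ whose intersection is not dense in $L$; if no such family exists, $\kappa(L)=\infty$ (larger than every cardinal). For a Banach space $Z$, $S_Z$ is its unit sphere; $\mathcal L(X,Y)$ is the space of bounded linear operators from $X$ to $Y$ with the operator norm. A pair of Banach spaces $(X,Y)$ over $\mathbb F$ has the Bishop--Phelps--Bollobás property (BPBp) if for every $\varepsilon\in(0,1)$ there exists $\eta(\varepsilon)>0$ such that whenever $T\in S_{\mathcal L(X,Y)}$ and $x_0\in S_X$ satisfy $\|Tx_0\|>1-\eta(\varepsilon)$, there exist $S\in S_{\mathcal L(X,Y)}$ and $u_0\in S_X$ such that $\|Su_0\|=1$, $\|u_0-x_0\|<\varepsilon$ and $\|S-T\|<\varepsilon$. *)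

theory Defs
  imports "HOL-Analysis.Analysis"
begin

unbundle cardinal_syntax

section \<open>Normed spaces over a scalar field and their bounded operators\<close>

text \<open>
  The type classes \<open>real_normed_vector\<close> and \<open>banach\<close> only provide real scalar multiplication.
  A normed space over \<open>'f\<close> (used with \<open>'f = real\<close> and \<open>'f = complex\<close>) is such a type together
  with a scalar multiplication by \<open>'f\<close> that extends the real one.
\<close>

locale normed_space_over = vector_space scale
  for scale :: "'f::real_normed_field \<Rightarrow> 'x::real_normed_vector \<Rightarrow> 'x" +
  assumes norm_scale: "norm (scale a x) = norm a * norm x"
    and scale_of_real: "scale (of_real r) x = r *\<^sub>R x"

lemma normed_space_over_scaleR:
  "normed_space_over (scaleR :: real \<Rightarrow> 'x::real_normed_vector \<Rightarrow> 'x)"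
  by unfold_locales (auto simp: algebra_simps)

lemma normed_space_over_real_iff:
  fixes s :: "real \<Rightarrow> 'x::real_normed_vector \<Rightarrow> 'x"
  shows "normed_space_over s \<longleftrightarrow> s = scaleR"
proof
  assume "normed_space_over s"
  then show "s = scaleR"
    using normed_space_over.scale_of_real[of s] by (intro ext) simp
qed (simp add: normed_space_over_scaleR)

text \<open>
  Elements of \<open>'x \<Rightarrow>\<^sub>L 'y\<close> are only real-linear, so linearity over the scalar field is imposed here.
  The operator norm does not depend on the scalar field.
\<close>

definition bounded_operators ::
  "('f::real_normed_field \<Rightarrow> 'x::real_normed_vector \<Rightarrow> 'x) \<Rightarrow>
   ('f \<Rightarrow> 'y::real_normed_vector \<Rightarrow> 'y) \<Rightarrow> ('x \<Rightarrow>\<^sub>L 'y) set" where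
  "bounded_operators scaleX scaleY =
     {T. Vector_Spaces.linear scaleX scaleY (blinfun_apply T)}"

definition BPBp ::
  "('f::real_normed_field \<Rightarrow> 'x::real_normed_vector \<Rightarrow> 'x) \<Rightarrow>
   ('f \<Rightarrow> 'y::real_normed_vector \<Rightarrow> 'y) \<Rightarrow> bool" where
  "BPBp scaleX scaleY \<longleftrightarrow>
     (\<forall>\<epsilon>::real. 0 < \<epsilon> \<and> \<epsilon> < 1 \<longrightarrow>
       (\<exists>\<eta>>0. \<forall>T \<in> bounded_operators scaleX scaleY. \<forall>x0.
          norm T = 1 \<and> norm x0 = 1 \<and> norm (blinfun_apply T x0) > 1 - \<eta> \<longrightarrow>
          (\<exists>S \<in> bounded_operators scaleX scaleY. \<exists>u0.
             norm S = 1 \<and> norm u0 = 1 \<and> norm (blinfun_apply S u0) = 1 \<and>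
             norm (u0 - x0) < \<epsilon> \<and> norm (S - T) < \<epsilon>)))"


section \<open>The space of continuous functions\<close>

text \<open>
  For compact \<open>'l\<close> every continuous function is bounded, so \<open>'l \<Rightarrow>\<^sub>C 'f\<close>, with its supremum norm,
  is the space of all continuous functions.
\<close>

lemma bcontfun_eq_continuous:
  assumes "compact (UNIV :: 'l::topological_space set)"
  shows "(bcontfun :: ('l \<Rightarrow> 'f::metric_space) set) = {f. continuous_on UNIV f}"
  using assms by (auto simp: bcontfun_def intro: compact_imp_bounded compact_continuous_image)

lemma norm_bcontfun_eq_SUP:
  "norm (f :: 'l::topological_space \<Rightarrow>\<^sub>C 'f::real_normed_vector) = (SUP t. norm (apply_bcontfun f t))"
  by (simp add: norm_bcontfun_def dist_bcontfun.rep_eq)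

definition scale_C ::
  "'f::real_normed_field \<Rightarrow> ('l::topological_space \<Rightarrow>\<^sub>C 'f) \<Rightarrow> ('l \<Rightarrow>\<^sub>C 'f)" where
  "scale_C a f = Bcontfun (\<lambda>t. a * apply_bcontfun f t)"

lemma apply_scale_C [simp]: "apply_bcontfun (scale_C a f) t = a * apply_bcontfun f t"
proof -
  have "bounded (range (\<lambda>t. a * apply_bcontfun f t))"
  proof -
    have "bounded ((\<lambda>y. a * y) ` range (apply_bcontfun f))"
      by (intro bounded_linear_image bounded_apply_bcontfun bounded_linear_mult_right)
    then show ?thesis by (simp add: image_image)
  qed
  then have "(\<lambda>t. a * apply_bcontfun f t) \<in> bcontfun"
    by (auto simp: bcontfun_def intro!: continuous_intros)
  then show ?thesis by (simp add: scale_C_def Bcontfun_inverse)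
qed

lemma normed_space_over_scale_C:
  "normed_space_over
     (scale_C :: 'f::real_normed_field \<Rightarrow> ('l::topological_space \<Rightarrow>\<^sub>C 'f) \<Rightarrow> ('l \<Rightarrow>\<^sub>C 'f))"
proof unfold_locales
  fix a :: 'f and f :: "'l \<Rightarrow>\<^sub>C 'f"
  have bdd: "bdd_above (range (\<lambda>t. norm (apply_bcontfun f t)))"
    using bounded_apply_bcontfun[of f] by (auto simp: bounded_iff bdd_above_def)
  have "(SUP t. norm a * norm (apply_bcontfun f t)) = norm a * (SUP t. norm (apply_bcontfun f t))"
    using continuous_at_Sup_mono
      [of "\<lambda>y. norm a * y" "range (\<lambda>t. norm (apply_bcontfun f t))"] bdd
    by (simp add: mono_def mult_left_mono image_image continuous_at_imp_continuous_at_within)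
  then show "norm (scale_C a f) = norm a * norm f"
    by (simp add: norm_bcontfun_eq_SUP norm_mult)
qed (auto intro!: bcontfun_eqI simp: algebra_simps scaleR_conv_of_real)


section \<open>Extremally disconnected spaces, density character and Baire number\<close>

definition extremally_disconnected :: "'l::topological_space itself \<Rightarrow> bool" where
  "extremally_disconnected _ \<longleftrightarrow> (\<forall>U :: 'l set. open U \<longrightarrow> open (closure U))"

text \<open>The least cardinality of a member of \<open>\<F>\<close>; meaningful only if \<open>\<F>\<close> is nonempty.\<close>

definition least_card :: "'a set set \<Rightarrow> 'a rel" where
  "least_card \<F> = card_of (SOME A. A \<in> \<F> \<and> (\<forall>B \<in> \<F>. |A| \<le>o |B| ))"

lemma least_card:
  assumes "\<F> \<noteq> {}"
  obtains A where "A \<in> \<F>" "least_card \<F> = |A|" "\<And>B. B \<in> \<F> \<Longrightarrow> |A| \<le>o |B|"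
proof -
  have "\<exists>r \<in> card_of ` \<F>. \<forall>r' \<in> card_of ` \<F>. r \<le>o r'"
    using assms by (intro exists_minim_Card_order) (auto intro: card_of_Card_order)
  then have "\<exists>A. A \<in> \<F> \<and> (\<forall>B \<in> \<F>. |A| \<le>o |B| )"
    by auto
  from someI_ex[OF this] show ?thesis
    using that unfolding least_card_def by blast
qed

definition density_character :: "'x::topological_space itself \<Rightarrow> 'x rel" where
  "density_character _ = least_card {D :: 'x set. closure D = UNIV}"

definition non_dense_families :: "'l::topological_space set set set" where
  "non_dense_families =
     {\<U>. (\<forall>U \<in> \<U>. open U \<and> closure U = UNIV) \<and> closure (\<Inter>\<U>) \<noteq> UNIV}"

text \<open>\<open>None\<close> stands for \<open>\<infinity>\<close>.\<close>

definition baire_number :: "'l::topological_space itself \<Rightarrow> 'l set rel option" where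
  "baire_number _ =
     (if (non_dense_families :: 'l set set set) = {} then None
      else Some (least_card (non_dense_families :: 'l set set set)))"

definition card_less_infty :: "'a rel \<Rightarrow> 'b rel option \<Rightarrow> bool" where
  "card_less_infty r k \<longleftrightarrow> (case k of None \<Rightarrow> True | Some s \<Rightarrow> r <o s)"

end

theory Submission
  imports Defs
begin

text \<open>
  For extremally disconnected \<open>L\<close> the real space \<open>C(L)\<close> is Dedekind complete, so the
  Hahn--Banach theorem holds for sublinear maps with values in \<open>C(L)\<close>. View \<open>T\<close> as a family of
  functionals \<open>T\<^sub>t\<close> (replaced by their real parts in the complex case) and consider
  \<open>q\<^sub>t x = inf\<^sub>y (\<parallel>y\<parallel> + T\<^sub>t (x - y) + e \<parallel>x - y\<parallel>)\<close>, the largest sublinear functional dominated by both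
  \<open>\<parallel>x\<parallel>\<close> and \<open>T\<^sub>t x + e \<parallel>x\<parallel>\<close>, together with the infimum \<open>Q x\<close> of the same family taken in \<open>C(L)\<close>.
  For each \<open>x\<close> and \<open>n\<close>, \<open>Q x\<close> and \<open>q x\<close> differ by less than \<open>1/n\<close> on a dense open set. Letting \<open>x\<close> run
  through a dense set of cardinality \<open>dens(X) < \<kappa>(L)\<close> yields a dense set of points \<open>t\<close> with
  \<open>Q x t = q\<^sub>t x\<close> for all \<open>x\<close>. At such a \<open>t\<close> with \<open>T\<^sub>t x\<^sub>0\<close> close to \<open>1\<close>, Ekeland's principle for
  \<open>\<parallel>y\<parallel> - T\<^sub>t y\<close> gives a unit vector \<open>u\<close> near \<open>x\<^sub>0\<close> with \<open>q\<^sub>t u = 1\<close>. A linear \<open>S \<le> Q\<close> with \<open>S u = Q u\<close> has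
  norm \<open>1\<close>, attains it at \<open>u\<close>, and is within \<open>e\<close> of \<open>T\<close>.
\<close>

section \<open>Infima of continuous functions on extremally disconnected spaces\<close>

text \<open>
  For a pointwise infimum that is only upper semicontinuous, this is its lower semicontinuous
  regularization, which extremal disconnectedness makes continuous.
\<close>

definition cinf :: "('l::topological_space \<Rightarrow> real) set \<Rightarrow> 'l \<Rightarrow> real" where
  "cinf F t = Inf {a. t \<in> closure {s. \<exists>f\<in>F. f s < a}}"

text \<open>Together with nonemptiness of \<open>F\<close>, the continuous minorant \<open>b\<close>
  keeps every set of levels nonempty and bounded below, so that \<open>cinf F t\<close> is a genuine
  infimum rather than a default value of \<open>Inf\<close>.\<close>

locale cinf_family =
  fixes F :: "('l::topological_space \<Rightarrow> real) set" and b :: "'l \<Rightarrow> real"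
  assumes ed: "extremally_disconnected TYPE('l)"
    and ne: "F \<noteq> {}"
    and cont: "\<And>f. f \<in> F \<Longrightarrow> continuous_on UNIV f"
    and bcont: "continuous_on UNIV b"
    and lb: "\<And>f t. f \<in> F \<Longrightarrow> b t \<le> f t"
begin

abbreviation levels :: "'l \<Rightarrow> real set" where
  "levels t \<equiv> {a. t \<in> closure {s. \<exists>f\<in>F. f s < a}}"

lemma open_sublevel: "open {s. \<exists>f\<in>F. f s < a}"
proof -
  have "{s. \<exists>f\<in>F. f s < a} = (\<Union>f\<in>F. {s. f s < a})" by auto
  then show ?thesis
    using cont by (auto intro!: open_UN open_Collect_less continuous_on_const)
qed

text \<open>The closed set where \<open>g \<le> a\<close> contains the sublevel set, hence its
  closure. With \<open>b\<close> for \<open>g\<close> this bounds the levels; with any continuous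
  minorant it makes \<open>cinf F\<close> the greatest one.\<close>

lemma lower_bound_levels:
  assumes g: "continuous_on UNIV g" and le: "\<And>f s. f \<in> F \<Longrightarrow> g s \<le> f s"
    and a: "a \<in> levels t"
  shows "g t \<le> a"
proof -
  have "closure {s. \<exists>f\<in>F. f s < a} \<subseteq> {s. g s \<le> a}"
  proof (intro closure_minimal closed_Collect_le g continuous_on_const subsetI)
    fix s assume "s \<in> {s. \<exists>f\<in>F. f s < a}"
    then obtain f where "f \<in> F" "f s < a" by auto
    then show "s \<in> {s. g s \<le> a}" using le[of f s] by simp
  qed
  then show ?thesis using a by auto
qed

lemma bdd_below_levels: "bdd_below (levels t)"
  by (rule bdd_belowI) (rule lower_bound_levels[of b], use bcont lb in auto)

lemma levels_ne: "f \<in> F \<Longrightarrow> f t < a \<Longrightarrow> a \<in> levels t"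
  using closure_subset[of "{s. \<exists>f\<in>F. f s < a}"] by auto

lemma levels_mono: "a \<in> levels t \<Longrightarrow> a \<le> a' \<Longrightarrow> a' \<in> levels t"
  using closure_mono[of "{s. \<exists>f\<in>F. f s < a}" "{s. \<exists>f\<in>F. f s < a'}"] by force

lemma levels_nonempty: "levels t \<noteq> {}"
proof -
  obtain f where "f \<in> F" using ne by auto
  then have "f t + 1 \<in> levels t" by (intro levels_ne) auto
  then show ?thesis by blast
qed

lemma cinf_lower: "f \<in> F \<Longrightarrow> cinf F t \<le> f t"
  unfolding cinf_def
  \<comment> \<open>Every \<open>a > f t\<close> is a level at \<open>t\<close>, since
    \<open>t\<close> itself lies in the sublevel set; \<open>dense_ge\<close> lets \<open>a\<close>
    decrease to \<open>f t\<close>.\<close>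
  by (rule dense_ge) (rule cInf_lower[OF levels_ne bdd_below_levels])

lemma cinf_greatest:
  assumes "continuous_on UNIV g" and "\<And>f s. f \<in> F \<Longrightarrow> g s \<le> f s"
  shows "g t \<le> cinf F t"
  unfolding cinf_def
  by (rule cInf_greatest[OF levels_nonempty], rule lower_bound_levels[of g]) (use assms in auto)

lemma cinf_less_iff: "cinf F t < a \<longleftrightarrow> (\<exists>a'<a. a' \<in> levels t)"
  unfolding cinf_def
  by (subst cInf_less_iff[OF levels_nonempty bdd_below_levels]) auto

lemma cinf_greater_iff: "a < cinf F t \<longleftrightarrow> (\<exists>a'>a. a' \<notin> levels t)"
proof
  assume "a < cinf F t"
  then obtain a' where "a < a'" "a' < cinf F t" using dense by blast
  then show "\<exists>a'>a. a' \<notin> levels t"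
    using cinf_less_iff[of t] cInf_lower[OF _ bdd_below_levels, of a' t]
    unfolding cinf_def by (intro exI[of _ a']) force
next
  assume "\<exists>a'>a. a' \<notin> levels t"
  then obtain a' where a': "a < a'" "a' \<notin> levels t" by auto
  have "a' \<le> cinf F t"
    unfolding cinf_def using a' levels_mono
    by (intro cInf_greatest levels_nonempty) (meson linear)
  then show "a < cinf F t" using a' by auto
qed

text \<open>Upper semicontinuity is where extremal disconnectedness enters: the set
  \<open>cinf F t < a\<close> is a union of closures of open sets. The set
  \<open>a < cinf F t\<close> is a union of complements of closures, open in any space.\<close>

lemma continuous_cinf: "continuous_on UNIV (cinf F)"
proof -
  have "open {t. cinf F t < a}" for a
  proof -
    have "{t. cinf F t < a} = (\<Union>a'\<in>{..<a}. closure {s. \<exists>f\<in>F. f s < a'})"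
      using cinf_less_iff by auto
    moreover have "open (closure {s. \<exists>f\<in>F. f s < a'})" for a'
      using ed open_sublevel unfolding extremally_disconnected_def by blast
    ultimately show ?thesis by auto
  qed
  moreover have "open {t. a < cinf F t}" for a
  proof -
    have "{t. a < cinf F t} = (\<Union>a'\<in>{a<..}. - closure {s. \<exists>f\<in>F. f s < a'})"
      using cinf_greater_iff by auto
    then show ?thesis by auto
  qed
  ultimately have "(cinf F \<longlongrightarrow> cinf F t) (at t)" for t
    by (intro order_tendstoI; unfold eventually_at_topological; blast)
  then show ?thesis by (simp add: continuous_on_def)
qed

lemma open_cinf_approx: "open {t. \<exists>f\<in>F. f t < cinf F t + e}"
proof -
  have "{t. \<exists>f\<in>F. f t < cinf F t + e} = (\<Union>f\<in>F. {t. f t < cinf F t + e})" by auto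
  then show ?thesis
    using cont continuous_cinf
    by (auto intro!: open_UN open_Collect_less continuous_on_const continuous_on_add)
qed

lemma dense_cinf_approx:
  assumes e: "e > 0"
  shows "closure {t. \<exists>f\<in>F. f t < cinf F t + e} = UNIV"
proof (rule ccontr)
  define V where "V = - closure {t. \<exists>f\<in>F. f t < cinf F t + e}"
  assume "closure {t. \<exists>f\<in>F. f t < cinf F t + e} \<noteq> UNIV"
  then obtain t where t: "t \<in> V" by (auto simp: V_def)
  \<comment> \<open>One half of \<open>e\<close> pays for the variation of \<open>cinf F\<close>
    near \<open>t\<close>, the other for a member of \<open>F\<close> that comes within
    \<open>e/2\<close> of \<open>cinf F t\<close> at a point of \<open>W\<close>.\<close>
  define W where "W = V \<inter> {s. cinf F t - e/2 < cinf F s}"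
  have "open W" unfolding W_def V_def
    by (intro open_Int open_Collect_less continuous_on_const continuous_cinf) auto
  moreover have "t \<in> W" using t e by (auto simp: W_def)
  moreover have "t \<in> closure {s. \<exists>f\<in>F. f s < cinf F t + e/2}"
    using cinf_less_iff[of t "cinf F t + e/2"] levels_mono[of _ t "cinf F t + e/2"] e by auto
  ultimately have "W \<inter> {s. \<exists>f\<in>F. f s < cinf F t + e/2} \<noteq> {}"
    using open_Int_closure_eq_empty[of W] by blast
  then obtain s f where "s \<in> W" "f \<in> F" "f s < cinf F t + e/2" by auto
  then have "s \<in> V" "\<exists>f\<in>F. f s < cinf F s + e"
    by (auto simp: W_def intro!: bexI[of _ f])
  then show False
    unfolding V_def using closure_subset[of "{t. \<exists>f\<in>F. f t < cinf F t + e}"] by auto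
qed

end


section \<open>Sublinear maps into spaces of continuous functions\<close>

text \<open>The homogeneity inequality is the form that passes directly to infima. Equality follows
  by using it for \<open>inverse c\<close> as well, and \<open>c = 2\<close> at the origin gives
  \<open>P 0 = 0\<close>.\<close>

definition csublinear :: "('x::real_vector \<Rightarrow> 'l::topological_space \<Rightarrow> real) \<Rightarrow> bool" where
  "csublinear P \<longleftrightarrow> (\<forall>x. continuous_on UNIV (P x)) \<and>
     (\<forall>x y t. P (x + y) t \<le> P x t + P y t) \<and>
     (\<forall>c x t. 0 < c \<longrightarrow> P (c *\<^sub>R x) t \<le> c * P x t)"

lemma csublinearD:
  assumes "csublinear P"
  shows "continuous_on UNIV (P x)" "P (x + y) t \<le> P x t + P y t"
    "0 < c \<Longrightarrow> P (c *\<^sub>R x) t \<le> c * P x t"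
  using assms by (auto simp: csublinear_def)

lemma csublinear_scale:
  assumes "csublinear P" "0 < c"
  shows "P (c *\<^sub>R x) t = c * P x t"
  using csublinearD(3)[OF assms(1), of "inverse c" "c *\<^sub>R x" t]
    csublinearD(3)[OF assms, of x t] assms(2)
  by (auto simp: field_simps)

lemma csublinear_zero:
  assumes "csublinear P"
  shows "P 0 t = 0"
  using csublinear_scale[OF assms, of 2 0 t] by auto

lemma csublinear_uminus_ge:
  assumes "csublinear P"
  shows "- P (- x) t \<le> P x t"
  using csublinearD(2)[OF assms, of x "- x" t] csublinear_zero[OF assms] by simp

text \<open>As \<open>cinf\<close> need not be a pointwise infimum, the two arguments are minimized
  one at a time: for fixed \<open>f\<close> the continuous function
  \<open>cinf (A (x + y)) - f\<close> is a minorant of \<open>A y\<close>, hence lies below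
  \<open>cinf (A y)\<close>; then \<open>f\<close> varies.\<close>

lemma csublinear_cinf:
  fixes A :: "'x::real_vector \<Rightarrow> ('l::topological_space \<Rightarrow> real) set"
  assumes A: "\<And>x. cinf_family (A x) (b x)"
    and add: "\<And>x y f g. f \<in> A x \<Longrightarrow> g \<in> A y \<Longrightarrow> \<exists>h\<in>A (x + y). \<forall>t. h t \<le> f t + g t"
    and scale: "\<And>c x f. 0 < c \<Longrightarrow> f \<in> A x \<Longrightarrow> \<exists>h\<in>A (c *\<^sub>R x). \<forall>t. h t \<le> c * f t"
  shows "csublinear (\<lambda>x. cinf (A x))"
  unfolding csublinear_def
proof (intro conjI allI impI)
  fix x y t
  interpret X: cinf_family "A x" "b x" by (rule A)
  interpret Y: cinf_family "A y" "b y" by (rule A)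
  interpret S: cinf_family "A (x + y)" "b (x + y)" by (rule A)
  show "continuous_on UNIV (cinf (A x))" by (rule X.continuous_cinf)
  have 1: "cinf (A (x + y)) s - f s \<le> g s" if fg: "f \<in> A x" "g \<in> A y" for f g s
  proof -
    obtain h where "h \<in> A (x + y)" "\<forall>t. h t \<le> f t + g t" using add fg by blast
    then show ?thesis using S.cinf_lower[of h s] by (smt (verit))
  qed
  have 2: "cinf (A (x + y)) s - f s \<le> cinf (A y) s" if "f \<in> A x" for f s
    using 1 that X.cont S.continuous_cinf
    by (intro Y.cinf_greatest) (auto intro!: continuous_intros)
  have "cinf (A (x + y)) t - cinf (A y) t \<le> cinf (A x) t"
    by (rule X.cinf_greatest)
      (use 2 S.continuous_cinf Y.continuous_cinf in \<open>auto intro!: continuous_intros simp: algebra_simps\<close>)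
  then show "cinf (A (x + y)) t \<le> cinf (A x) t + cinf (A y) t" by simp
next
  fix c :: real and x t
  assume c: "0 < c"
  interpret X: cinf_family "A x" "b x" by (rule A)
  interpret S: cinf_family "A (c *\<^sub>R x)" "b (c *\<^sub>R x)" by (rule A)
  have 1: "cinf (A (c *\<^sub>R x)) s / c \<le> f s" if f: "f \<in> A x" for f s
  proof -
    obtain h where "h \<in> A (c *\<^sub>R x)" "\<forall>t. h t \<le> c * f t" using scale c f by blast
    then have "cinf (A (c *\<^sub>R x)) s \<le> c * f s" using S.cinf_lower[of h s] by (smt (verit))
    then show ?thesis using c by (simp add: field_simps)
  qed
  have "cinf (A (c *\<^sub>R x)) t / c \<le> cinf (A x) t"
    using c by (intro X.cinf_greatest 1) (auto intro!: continuous_intros S.continuous_cinf)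
  then show "cinf (A (c *\<^sub>R x)) t \<le> c * cinf (A x) t"
    using c by (simp add: field_simps)
qed

text \<open>The infimum over \<open>r \<ge> 0\<close> of \<open>P (x + r u) - r P u\<close> is below
  \<open>P\<close> by \<open>r = 0\<close>, and \<open>r = 1\<close> at \<open>x = - u\<close> gives
  \<open>P 0 - P u\<close>. It is finite because
  \<open>P (r u) \<le> P (x + r u) + P (- x)\<close>.\<close>

lemma csublinear_tighten:
  fixes P :: "'x::real_vector \<Rightarrow> 'l::topological_space \<Rightarrow> real"
  assumes ed: "extremally_disconnected TYPE('l)" and P: "csublinear P"
  obtains P' where "csublinear P'" "P' \<le> P" "\<And>t. P' (- u) t \<le> - P u t"
proof -
  define A where "A x = {\<lambda>t. P (x + r *\<^sub>R u) t - r * P u t | r. 0 \<le> r}" for x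
  have scale: "P (r *\<^sub>R x) t = r * P x t" if "0 \<le> r" for r x t
    using that csublinear_scale[OF P, of r x t] csublinear_zero[OF P, of t]
    by (cases "r = 0") auto
  have fam: "cinf_family (A x) (\<lambda>t. - P (- x) t)" for x
  proof
    fix f t assume "f \<in> A x"
    then obtain r where r: "0 \<le> r" "f = (\<lambda>t. P (x + r *\<^sub>R u) t - r * P u t)"
      by (auto simp: A_def)
    then show "- P (- x) t \<le> f t"
      using csublinearD(2)[OF P, of "x + r *\<^sub>R u" "- x" t] scale by auto
    show "continuous_on UNIV f"
      unfolding r by (intro continuous_intros csublinearD(1)[OF P])
  qed (use ed in \<open>auto simp: A_def intro!: continuous_intros csublinearD(1)[OF P]\<close>)
  have "csublinear (\<lambda>x. cinf (A x))"
  proof (rule csublinear_cinf[OF fam])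
    fix x y f g assume "f \<in> A x" "g \<in> A y"
    then obtain r s where r: "0 \<le> r" "f = (\<lambda>t. P (x + r *\<^sub>R u) t - r * P u t)"
      and s: "0 \<le> s" "g = (\<lambda>t. P (y + s *\<^sub>R u) t - s * P u t)"
      by (auto simp: A_def)
    have "P (x + y + (r + s) *\<^sub>R u) t \<le> P (x + r *\<^sub>R u) t + P (y + s *\<^sub>R u) t" for t
      using csublinearD(2)[OF P, of "x + r *\<^sub>R u" "y + s *\<^sub>R u" t]
      by (simp add: algebra_simps)
    then show "\<exists>h\<in>A (x + y). \<forall>t. h t \<le> f t + g t"
      using r s
      by (intro bexI[of _ "\<lambda>t. P (x + y + (r + s) *\<^sub>R u) t - (r + s) * P u t"])
        (auto simp: A_def algebra_simps intro!: exI[of _ "r + s"])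
  next
    fix c :: real and x f assume c: "0 < c" and "f \<in> A x"
    then obtain r where r: "0 \<le> r" "f = (\<lambda>t. P (x + r *\<^sub>R u) t - r * P u t)"
      by (auto simp: A_def)
    have "P (c *\<^sub>R x + (c * r) *\<^sub>R u) t = c * P (x + r *\<^sub>R u) t" for t
      using scale[of c "x + r *\<^sub>R u" t] c by (simp add: algebra_simps)
    then show "\<exists>h\<in>A (c *\<^sub>R x). \<forall>t. h t \<le> c * f t"
      using r c
      by (intro bexI[of _ "\<lambda>t. P (c *\<^sub>R x + (c * r) *\<^sub>R u) t - (c * r) * P u t"])
        (auto simp: A_def algebra_simps intro!: exI[of _ "c * r"])
  qed
  moreover have "(\<lambda>x. cinf (A x)) \<le> P"
  proof (intro le_funI)
    fix x t
    have "P x \<in> A x" by (auto simp: A_def intro!: exI[of _ 0])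
    then show "cinf (A x) t \<le> P x t" using cinf_family.cinf_lower[OF fam] by blast
  qed
  moreover have "cinf (A (- u)) t \<le> - P u t" for t
  proof -
    have "(\<lambda>t. - P u t) \<in> A (- u)"
      by (auto simp: A_def csublinear_zero[OF P] intro!: exI[of _ 1])
    then show ?thesis using cinf_family.cinf_lower[OF fam] by blast
  qed
  ultimately show thesis by (rule that)
qed

text \<open>A minimal sublinear map below \<open>Q\<close> is linear, because tightening it at any point changes nothing.\<close>

theorem hahn_banach_kantorovich:
  fixes Q :: "'x::real_vector \<Rightarrow> 'l::topological_space \<Rightarrow> real"
  assumes ed: "extremally_disconnected TYPE('l)" and Q: "csublinear Q"
  obtains S where "\<And>x. continuous_on UNIV (S x)" "\<And>t. linear (\<lambda>x. S x t)"
    "\<And>x t. S x t \<le> Q x t" "S u = Q u"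
proof -
  \<comment> \<open>Minimizing below the tightening at \<open>u\<close>, instead of below
    \<open>Q\<close>, is what will force \<open>S u = Q u\<close>: it gives
    \<open>S (- u) \<le> - Q u\<close>, and \<open>S\<close> is odd.\<close>
  obtain Q' where Q': "csublinear Q'" "Q' \<le> Q" "\<And>t. Q' (- u) t \<le> - Q u t"
    using csublinear_tighten[OF ed Q] by blast
  define \<P> where "\<P> = {P. csublinear P \<and> P \<le> Q'}"
  have "\<exists>P\<in>\<P>. \<forall>P'\<in>\<P>. P \<ge> P' \<longrightarrow> P' = P"
  proof (rule predicate_Zorn)
    show "partial_order_on \<P> (relation_of (\<ge>) \<P>)"
      by (auto simp: partial_order_on_def preorder_on_def refl_on_def trans_def antisym_def
          relation_of_def)
    fix C assume C: "C \<in> Chains (relation_of (\<ge>) \<P>)"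
    then have C\<P>: "C \<subseteq> \<P>" and total: "\<And>P P'. P \<in> C \<Longrightarrow> P' \<in> C \<Longrightarrow> P \<le> P' \<or> P' \<le> P"
      by (auto simp: Chains_def relation_of_def)
    show "\<exists>P\<in>\<P>. \<forall>P'\<in>C. P' \<ge> P"
    proof (cases "C = {}")
      case True
      then show ?thesis using Q' by (auto simp: \<P>_def)
    next
      case False
      define A where "A x = {P x | P. P \<in> C}" for x
      \<comment> \<open>A minorant common to the whole chain:
        \<open>P x \<ge> - P (- x) \<ge> - Q' (- x)\<close> for each
        \<open>P \<le> Q'\<close>.\<close>
      have fam: "cinf_family (A x) (\<lambda>t. - Q' (- x) t)" for x
      proof
        fix f t assume "f \<in> A x"
        then obtain P where P: "csublinear P" "P \<le> Q'" "f = P x"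
          using C\<P> by (auto simp: A_def \<P>_def)
        show "continuous_on UNIV f" using P csublinearD(1) by auto
        have "P (- x) t \<le> Q' (- x) t" using P(2) by (auto simp: le_fun_def)
        then show "- Q' (- x) t \<le> f t"
          using csublinear_uminus_ge[OF P(1), of x t] P(3) by auto
      next
        show "continuous_on UNIV (\<lambda>t. - Q' (- x) t)"
          by (intro continuous_on_minus csublinearD(1)[OF Q'(1)])
        show "A x \<noteq> {}" using False by (auto simp: A_def)
      qed (rule ed)
      have sub: "csublinear (\<lambda>x. cinf (A x))"
      proof (rule csublinear_cinf[OF fam])
        fix x y f g assume "f \<in> A x" "g \<in> A y"
        then obtain P P' where P: "P \<in> C" "f = P x" "P' \<in> C" "g = P' y"
          by (auto simp: A_def)
        obtain R where R: "R \<in> C" "R \<le> P" "R \<le> P'"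
          using total[OF P(1,3)] P by auto
        then have "csublinear R" using C\<P> by (auto simp: \<P>_def)
        then have "R (x + y) t \<le> P x t + P' y t" for t
          using csublinearD(2)[of R x y t] R(2,3) unfolding le_fun_def
          by (meson add_mono order_trans)
        then show "\<exists>h\<in>A (x + y). \<forall>t. h t \<le> f t + g t"
          using P R by (auto simp: A_def)
      next
        fix c :: real and x f assume "0 < c" and "f \<in> A x"
        then obtain P where P: "P \<in> C" "f = P x" by (auto simp: A_def)
        then have "csublinear P" using C\<P> by (auto simp: \<P>_def)
        then show "\<exists>h\<in>A (c *\<^sub>R x). \<forall>t. h t \<le> c * f t"
          using P csublinearD(3)[OF _ \<open>0 < c\<close>, of P] by (auto simp: A_def)
      qed
      have le: "(\<lambda>x. cinf (A x)) \<le> P" if "P \<in> C" for P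
        using that cinf_family.cinf_lower[OF fam] by (fastforce simp: le_fun_def A_def)
      obtain P where P: "P \<in> C" using False by auto
      then have "P \<le> Q'" using C\<P> by (auto simp: \<P>_def)
      with le[OF P] have "(\<lambda>x. cinf (A x)) \<le> Q'" by (rule order_trans)
      then show ?thesis using sub le by (auto simp: \<P>_def)
    qed
  qed
  then obtain S where S\<P>: "S \<in> \<P>" and max: "\<forall>P'\<in>\<P>. S \<ge> P' \<longrightarrow> P' = S"
    by blast
  then have S: "csublinear S" "S \<le> Q'" by (auto simp: \<P>_def)
  have min: "P = S" if "csublinear P" "P \<le> S" for P
    using max that order_trans[OF that(2) S(2)] by (auto simp: \<P>_def)
  have "S (- x) t \<le> - S x t" for x t
    using csublinear_tighten[OF ed S(1), of x] min by metis
  then have neg: "S (- x) t = - S x t" for x t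
    using csublinear_uminus_ge[OF S(1), of "- x" t] by (intro antisym) auto
  have lin: "linear (\<lambda>x. S x t)" for t
  proof
    fix x y
    show "S (x + y) t = S x t + S y t"
      using csublinearD(2)[OF S(1), of x y t] csublinearD(2)[OF S(1), of "- x" "- y" t]
        neg[of "x + y" t] neg[of x t] neg[of y t]
      by (simp add: algebra_simps)
  next
    fix r :: real and x
    consider "r = 0" | "r > 0" | "- r > 0" by linarith
    then show "S (r *\<^sub>R x) t = r *\<^sub>R S x t"
      by cases (use csublinear_zero[OF S(1)] csublinear_scale[OF S(1), of r x t]
          csublinear_scale[OF S(1), of "- r" x t] neg[of "r *\<^sub>R x" t] in auto)
  qed
  have le: "S x t \<le> Q x t" for x t
    using S(2) Q'(2) by (meson le_fun_def order_trans)
  have "S (- u) t \<le> - Q u t" for t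
    using le_funD[OF le_funD[OF S(2)], of "- u" t] Q'(3)[of t] by linarith
  then have "S u = Q u"
    using le neg by (intro ext antisym) auto
  with csublinearD(1)[OF S(1)] lin le show thesis by (rule that)
qed


section \<open>Ekeland's variational principle\<close>

text \<open>\<open>D x\<close> is the set of points below \<open>x\<close> in Ekeland's order. Each
  \<open>X (Suc n)\<close> nearly minimizes \<open>f\<close> on \<open>D (X n)\<close>, which makes
  the sequence Cauchy. Its limit \<open>v\<close> lies in every \<open>D (X n)\<close>, and so does
  each \<open>y\<close> in \<open>D v\<close>; near-minimality then excludes
  \<open>f y < f v\<close>.\<close>

lemma ekeland:
  fixes f :: "'a::complete_space \<Rightarrow> real"
  assumes cont: "continuous_on UNIV f" and nonneg: "\<And>x. 0 \<le> f x" and e: "0 < e"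
  obtains v where "f v + e * dist x0 v \<le> f x0" "\<And>y. f v \<le> f y + e * dist v y"
proof -
  define D where "D x = {y. f y + e * dist x y \<le> f x}" for x
  have D_refl: "x \<in> D x" for x by (simp add: D_def)
  have D_trans: "z \<in> D x" if "y \<in> D x" "z \<in> D y" for x y z
  proof -
    have "e * dist x z \<le> e * dist x y + e * dist y z"
      using e dist_triangle[of x z y] by (simp flip: distrib_left)
    then show ?thesis using that by (auto simp: D_def)
  qed
  have bdd: "bdd_below (f ` B)" for B using nonneg by (auto simp: bdd_below_def)
  have "\<forall>n y. \<exists>z. z \<in> D y \<and> f z < Inf (f ` D y) + (1/2)^n"
  proof (intro allI)
    fix n :: nat and y
    have "f ` D y \<noteq> {}" using D_refl by auto
    from cInf_less_iff[OF this bdd, of "Inf (f ` D y) + (1/2)^n"]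
    show "\<exists>z. z \<in> D y \<and> f z < Inf (f ` D y) + (1/2)^n" by auto
  qed
  then obtain nxt where nxt: "nxt n y \<in> D y" "f (nxt n y) < Inf (f ` D y) + (1/2)^n" for n y
    by metis
  define X where "X = rec_nat x0 nxt"
  have X0: "X 0 = x0" and XS: "X (Suc n) = nxt n (X n)" for n by (auto simp: X_def)
  have X_D: "X m \<in> D (X n)" if "n \<le> m" for n m
    using that by (induction m rule: dec_induct) (auto simp: XS D_refl intro: D_trans nxt)
  have approx: "f (X (Suc n)) < f y + (1/2)^n" if "y \<in> D (X n)" for n y
    using nxt(2)[of n "X n"] cInf_lower[of "f y" "f ` D (X n)"] bdd that by (force simp: XS)
  \<comment> \<open>Membership in \<open>D (X (Suc n))\<close> costs a decrease of \<open>f\<close>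
    by \<open>e\<close> times the distance, while \<open>approx\<close> leaves room for less than
    \<open>(1/2)^n\<close>.\<close>
  have near: "e * dist (X (Suc n)) y < (1/2)^n" if "y \<in> D (X (Suc n))" for n y
  proof -
    have "y \<in> D (X n)" using that X_D[of n "Suc n"] by (auto intro: D_trans)
    then show ?thesis using approx[of y n] that by (auto simp: D_def)
  qed
  have "Cauchy X"
  proof (rule metric_CauchyI)
    fix d :: real assume d: "0 < d"
    then obtain n where n: "(1/2)^n < e * (d/2)"
      using real_arch_pow_inv[of "e * (d/2)" "1/2"] e by auto
    have *: "dist (X (Suc n)) (X m) < d/2" if "Suc n \<le> m" for m
      using near[OF X_D[OF that]] n e by (smt (verit) mult_less_cancel_left_pos)
    show "\<exists>M. \<forall>m\<ge>M. \<forall>k\<ge>M. dist (X m) (X k) < d"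
    proof (intro exI[of _ "Suc n"] allI impI)
      fix m k assume "Suc n \<le> m" "Suc n \<le> k"
      then show "dist (X m) (X k) < d"
        using *[of m] *[of k] dist_triangle3[of "X m" "X k" "X (Suc n)"] by linarith
    qed
  qed
  then obtain v where v: "X \<longlonglongrightarrow> v" using Cauchy_convergent_iff convergent_def by blast
  have "closed (D x)" for x
    unfolding D_def by (intro closed_Collect_le continuous_intros cont)
  then have vD: "v \<in> D (X n)" for n
    using v X_D
    by (intro closed_sequentially[of "D (X n)" "\<lambda>m. X (m + n)" v])
      (auto simp: LIMSEQ_ignore_initial_segment)
  show thesis
  proof (rule that)
    show "f v + e * dist x0 v \<le> f x0" using vD[of 0] by (simp add: D_def X0)
    fix y
    show "f v \<le> f y + e * dist v y"
    proof (rule ccontr)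
      assume "\<not> ?thesis"
      moreover have "0 \<le> e * dist v y" using e by simp
      ultimately have y: "y \<in> D v" "f y < f v"
        unfolding D_def by auto
      have less: "f v < f y + (1/2)^n" for n
      proof -
        have "0 \<le> e * dist (X (Suc n)) v" using e by simp
        then have "f v \<le> f (X (Suc n))" using vD[of "Suc n"] by (simp add: D_def)
        then show ?thesis using approx[OF D_trans[OF vD y(1)], of n] by linarith
      qed
      obtain n where "(1/2)^n < f v - f y"
        using real_arch_pow_inv[of "f v - f y" "1/2"] y by auto
      then show False using less[of n] by linarith
    qed
  qed
qed

text \<open>
  The conclusion says that some functional in the unit ball, within \<open>e\<close> of \<open>\<phi>\<close>, attains its norm
  \<open>1\<close> at \<open>u\<close>.
\<close>

lemma bishop_phelps_bollobas_functional:
  fixes \<phi> :: "'x::banach \<Rightarrow> real"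
  assumes lin: "linear \<phi>" and bound: "\<And>x. \<bar>\<phi> x\<bar> \<le> norm x" and e: "0 < e" "e < 1"
    and x0: "norm x0 = 1" "\<phi> x0 > 1 - e\<^sup>2 / 2"
  obtains u where "norm u = 1" "norm (u - x0) < e"
    "\<And>y. 1 \<le> norm y + \<phi> (u - y) + e * norm (u - y)"
proof -
  interpret linear \<phi> by (rule lin)
  have "bounded_linear \<phi>"
    using lin bound
    by (intro bounded_linear.intro bounded_linear_axioms.intro exI[of _ 1]) auto
  then have "continuous_on UNIV (\<lambda>x. norm x - \<phi> x)"
    by (intro continuous_on_diff continuous_on_norm_id linear_continuous_on)
  moreover have "0 \<le> norm x - \<phi> x" for x using bound[of x] by simp
  ultimately obtain v where v: "norm v - \<phi> v + e * dist x0 v \<le> norm x0 - \<phi> x0"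
    "\<And>y. norm v - \<phi> v \<le> norm y - \<phi> y + e * dist v y"
    using ekeland[of "\<lambda>x. norm x - \<phi> x" e x0] e by blast
  \<comment> \<open>This fixes the constant \<open>e\<^sup>2 / 2\<close>: it puts \<open>v\<close>
    within \<open>e / 2\<close> of \<open>x0\<close>, and normalizing \<open>v\<close> moves it by
    less than another \<open>e / 2\<close>.\<close>
  have "e * dist x0 v < e * (e / 2)"
    using v(1) bound[of v] x0 by (simp add: power2_eq_square)
  then have d: "norm (v - x0) < e / 2"
    using e by (simp add: dist_norm norm_minus_commute)
  have nv: "\<bar>norm v - 1\<bar> < e / 2"
    using norm_triangle_ineq3[of v x0] d x0(1) by linarith
  then have pos: "norm v > 0" using e by linarith
  define u where "u = v /\<^sub>R norm v"
  have v_eq: "v = norm v *\<^sub>R u" using pos by (simp add: u_def)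
  have nu: "norm u = 1" using pos by (simp add: u_def)
  have "norm (u - v) = \<bar>1 - norm v\<bar>"
  proof -
    have "u - v = (1 - norm v) *\<^sub>R u" using v_eq by (simp add: algebra_simps)
    then show ?thesis using nu by simp
  qed
  then have "norm (u - x0) < e"
    using norm_triangle_ineq[of "u - v" "v - x0"] d nv by (simp add: abs_minus_commute)
  moreover have "1 \<le> norm y + \<phi> (u - y) + e * norm (u - y)" for y
  proof -
    \<comment> \<open>Tested at \<open>norm v *\<^sub>R y\<close>, the variational inequality is
      \<open>norm v\<close> times the inequality wanted at \<open>u\<close>.\<close>
    have "norm v - \<phi> v \<le> norm (norm v *\<^sub>R y) - \<phi> (norm v *\<^sub>R y) + e * dist v (norm v *\<^sub>R y)"
      by (rule v(2))
    moreover have "\<phi> v = norm v * \<phi> u" using v_eq scale[of "norm v" u] by simp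
    moreover have "dist v (norm v *\<^sub>R y) = norm v * norm (u - y)"
    proof -
      have "v - norm v *\<^sub>R y = norm v *\<^sub>R (u - y)" using v_eq by (simp add: algebra_simps)
      then show ?thesis by (simp add: dist_norm)
    qed
    ultimately have "norm v * 1 \<le> norm v * (norm y + \<phi> u - \<phi> y + e * norm (u - y))"
      by (simp add: scale algebra_simps)
    then have "1 \<le> norm y + \<phi> u - \<phi> y + e * norm (u - y)"
      using pos by (simp only: mult_le_cancel_left_pos)
    then show ?thesis by (simp add: diff)
  qed
  ultimately show thesis using nu that by blast
qed


section \<open>The Bishop--Phelps--Bollobas property\<close>

text \<open>Take \<open>D\<close> dense of least cardinality. Since \<open>D\<close> is infinite,
  the countable index \<open>n\<close> is absorbed, so the sets \<open>W x n\<close> with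
  \<open>x\<close> in \<open>D\<close> are fewer than the Baire number and cannot form a non-dense
  family.\<close>

lemma countable_dense_refinement:
  fixes W :: "'x::topological_space \<Rightarrow> nat \<Rightarrow> 'l::topological_space set"
  assumes card: "card_less_infty (density_character TYPE('x)) (baire_number TYPE('l))"
    and inf: "\<And>D :: 'x set. closure D = UNIV \<Longrightarrow> infinite D"
    and W: "\<And>x n. open (W x n)" "\<And>x n. closure (W x n) = UNIV"
  obtains D where "closure D = UNIV" "closure (\<Inter>x\<in>D. \<Inter>n. W x n) = UNIV"
proof -
  obtain D :: "'x set" where D: "closure D = UNIV" "density_character TYPE('x) = |D|"
    using least_card[of "{D :: 'x set. closure D = UNIV}"]
    unfolding density_character_def by (metis (mono_tags) closure_UNIV empty_iff mem_Collect_eq)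
  define \<U> where "\<U> = (\<lambda>(x, n). W x n) ` (D \<times> UNIV)"
  have U_eq: "\<Inter>\<U> = (\<Inter>x\<in>D. \<Inter>n. W x n)" by (auto simp: \<U>_def)
  have "\<U> \<notin> non_dense_families"
  proof
    assume U: "\<U> \<in> non_dense_families"
    then have ne: "(non_dense_families :: 'l set set set) \<noteq> {}" by auto
    then obtain A :: "'l set set" where A: "least_card non_dense_families = |A|"
      "\<And>B. B \<in> (non_dense_families :: 'l set set set) \<Longrightarrow> |A| \<le>o |B|"
      using least_card by metis
    have "|D| <o |A|"
      using card ne A(1) D(2) by (simp add: card_less_infty_def baire_number_def)
    also have "|A| \<le>o |\<U>|" using A(2) U by auto
    also have "|\<U>| \<le>o |D \<times> (UNIV :: nat set)|" unfolding \<U>_def by (rule card_of_image)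
    also have "|D \<times> (UNIV :: nat set)| \<le>o |D|"
      using inf[OF D(1)]
      by (intro card_of_Times_ordLeq_infinite_Field card_of_Card_order card_of_refl[THEN ordIso_imp_ordLeq])
        (auto simp: infinite_iff_card_of_nat[symmetric] Field_card_of)
    finally show False using ordLess_irreflexive by blast
  qed
  then have "closure (\<Inter>\<U>) = UNIV" using W by (auto simp: non_dense_families_def \<U>_def)
  then show thesis using that D(1) U_eq by simp
qed

lemma infinite_dense_subset:
  fixes x0 :: "'x::real_normed_vector"
  assumes "x0 \<noteq> 0" and D: "closure (D :: 'x set) = UNIV"
  shows "infinite D"
proof
  assume "finite D"
  then have "closure D = D" by (simp add: finite_imp_closed)
  then have "finite (UNIV :: 'x set)" using D \<open>finite D\<close> by simp
  moreover have "inj (\<lambda>r. r *\<^sub>R x0)" using assms(1) by (auto intro: injI)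
  ultimately have "finite (UNIV :: real set)" by (metis finite_imageD finite_subset subset_UNIV)
  then show False using infinite_UNIV_char_0 by blast
qed

lemma real_operator_approximation:
  fixes T :: "'x::banach \<Rightarrow> 'l::topological_space \<Rightarrow> real"
  assumes ed: "extremally_disconnected TYPE('l)"
    and card: "card_less_infty (density_character TYPE('x)) (baire_number TYPE('l))"
    and T: "\<And>x. continuous_on UNIV (T x)" "\<And>t. linear (\<lambda>x. T x t)" "\<And>x t. \<bar>T x t\<bar> \<le> norm x"
    and e: "0 < e" "e < 1" and x0: "norm x0 = 1" "T x0 t0 > 1 - e\<^sup>2 / 2"
  obtains S u t where "\<And>x. continuous_on UNIV (S x)" "\<And>t. linear (\<lambda>x. S x t)"
    "\<And>x t. \<bar>S x t\<bar> \<le> norm x" "\<And>x t. \<bar>S x t - T x t\<bar> \<le> e * norm x"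
    "norm u = 1" "norm (u - x0) < e" "S u t = 1"
proof -
  note T_lin = linear_add[OF T(2)] linear_diff[OF T(2)] linear_scale[OF T(2)] linear_neg[OF T(2)]
    linear_0[OF T(2)]
  define q where "q x y t = norm y + T (x - y) t + e * norm (x - y)" for x y t
  define A where "A x = range (q x)" for x
  define Q where "Q x = cinf (A x)" for x
  have fam: "cinf_family (A x) (\<lambda>t. - norm x)" for x
  proof
    fix f t assume "f \<in> A x"
    then obtain y where f: "f = q x y" by (auto simp: A_def)
    show "continuous_on UNIV f"
      unfolding f q_def by (intro continuous_intros T)
    have "norm (x - y) \<le> norm x + norm y" by (rule norm_triangle_ineq4)
    moreover have "0 \<le> e * norm (x - y)" using e by simp
    ultimately show "- norm x \<le> f t"
      using T(3)[of "x - y" t] unfolding f q_def by linarith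
  qed (use ed in \<open>auto simp: A_def\<close>)
  have Q: "csublinear Q"
    unfolding Q_def
  proof (rule csublinear_cinf[OF fam])
    fix x y f g assume "f \<in> A x" "g \<in> A y"
    then obtain x' y' where f: "f = q x x'" "g = q y y'" by (auto simp: A_def)
    have "q (x + y) (x' + y') t \<le> f t + g t" for t
    proof -
      have "e * norm (x + y - (x' + y')) \<le> e * norm (x - x') + e * norm (y - y')"
        using e norm_diff_triangle_ineq[of x y x' y'] by (simp flip: distrib_left)
      then show ?thesis
        using norm_triangle_ineq[of x' y'] unfolding f q_def by (simp add: T_lin)
    qed
    then show "\<exists>h\<in>A (x + y). \<forall>t. h t \<le> f t + g t" by (auto simp: A_def)
  next
    fix c :: real and x f assume c: "0 < c" and "f \<in> A x"
    then obtain y where f: "f = q x y" by (auto simp: A_def)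
    have "q (c *\<^sub>R x) (c *\<^sub>R y) t = c * f t" for t
    proof -
      have "norm (c *\<^sub>R x - c *\<^sub>R y) = c * norm (x - y)"
        using c by (simp flip: scaleR_right_diff_distrib)
      then show ?thesis using c unfolding f q_def by (simp add: T_lin algebra_simps)
    qed
    then show "\<exists>h\<in>A (c *\<^sub>R x). \<forall>t. h t \<le> c * f t"
      by (intro bexI[of _ "q (c *\<^sub>R x) (c *\<^sub>R y)"]) (auto simp: A_def)
  qed
  have Q_le: "Q x t \<le> q x y t" for x y t
    unfolding Q_def by (rule cinf_family.cinf_lower[OF fam]) (simp add: A_def)
  \<comment> \<open>The choices \<open>y = x\<close> and \<open>y = 0\<close>. Used at
    \<open>x\<close> and \<open>- x\<close>, the two bounds make any linear \<open>S\<close> below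
    \<open>Q\<close> a contraction within \<open>e\<close> of \<open>T\<close>.\<close>
  have Q_norm: "Q x t \<le> norm x" for x t using Q_le[of x t x] by (simp add: q_def T_lin)
  have Q_T: "Q x t \<le> T x t + e * norm x" for x t using Q_le[of x t 0] by (simp add: q_def)

  \<comment> \<open>A point lying in \<open>W x n\<close> for all \<open>n\<close> is one where
    \<open>Q x\<close> equals the pointwise infimum of \<open>A x\<close>.\<close>
  define W where "W x n = {t. \<exists>f\<in>A x. f t < Q x t + inverse (Suc n)}" for x n
  have "open (W x n)" "closure (W x n) = UNIV" for x n
    unfolding W_def Q_def
    by (rule cinf_family.open_cinf_approx[OF fam])
      (rule cinf_family.dense_cinf_approx[OF fam], simp)
  moreover have "infinite D" if "closure D = UNIV" for D :: "'x set"
  proof (rule infinite_dense_subset[OF _ that])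
    show "x0 \<noteq> 0" using x0(1) by auto
  qed
  ultimately obtain D where D: "closure D = UNIV"
    and G: "closure (\<Inter>x\<in>D. \<Inter>n. W x n) = UNIV"
    using countable_dense_refinement[OF card, of W] by blast
  \<comment> \<open>This open set contains \<open>t0\<close>, so it meets the dense set of good
    points; the point \<open>t\<close> found there replaces \<open>t0\<close>.\<close>
  have "open {t. T x0 t > 1 - e\<^sup>2 / 2}"
    by (intro open_Collect_less continuous_intros T)
  from open_Int_closure_eq_empty[OF this, of "\<Inter>x\<in>D. \<Inter>n. W x n"]
  have "{t. T x0 t > 1 - e\<^sup>2 / 2} \<inter> (\<Inter>x\<in>D. \<Inter>n. W x n) \<noteq> {}"
    using x0(2) unfolding G by auto
  then obtain t where t: "T x0 t > 1 - e\<^sup>2 / 2" "\<And>x n. x \<in> D \<Longrightarrow> t \<in> W x n"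
    by blast
  obtain u where u: "norm u = 1" "norm (u - x0) < e" "\<And>y. 1 \<le> q u y t"
    using bishop_phelps_bollobas_functional[OF T(2) T(3) e x0(1) t(1)] unfolding q_def by blast

  \<comment> \<open>As \<open>u\<close> need not lie in \<open>D\<close>, a nearby \<open>x\<close>
    in \<open>D\<close> is used. Passing from \<open>u\<close> to \<open>x\<close> costs at most
    \<open>d\<close> in the \<open>T\<close> term, \<open>d\<close> in the \<open>e\<close> term
    because \<open>e < 1\<close>, and \<open>d\<close> in
    \<open>Q x \<le> Q u + Q (x - u)\<close>.\<close>
  have key: "1 \<le> Q u t + 3 * d" if d: "d > 0" for d
  proof -
    obtain x where x: "x \<in> D" "norm (x - u) < d"
      using D d closure_approachable[of u D] by (auto simp: dist_norm)
    have "1 - 2 * d \<le> Q x t + inverse (Suc n)" for n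
    proof -
      obtain y where y: "q x y t < Q x t + inverse (Suc n)"
        using t(2)[OF x(1), of n] by (auto simp: W_def A_def)
      have "T (u - y) t - T (x - y) t \<le> norm (x - u)"
        using T(3)[of "x - u" t] by (simp add: T_lin)
      moreover have "e * norm (u - y) \<le> e * norm (x - y) + norm (x - u)"
      proof -
        have "e * norm (u - y) \<le> e * (norm (x - y) + norm (x - u))"
          using norm_triangle_ineq4[of "x - y" "x - u"] e by simp
        also have "\<dots> \<le> e * norm (x - y) + norm (x - u)"
          using e by (simp add: distrib_left mult_left_le_one_le)
        finally show ?thesis .
      qed
      ultimately show ?thesis
        using u(3)[of y] x(2) y unfolding q_def by linarith
    qed
    moreover have "(\<lambda>n. Q x t + inverse (Suc n)) \<longlonglongrightarrow> Q x t + 0"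
      by (intro tendsto_intros LIMSEQ_inverse_real_of_nat)
    ultimately have "1 - 2 * d \<le> Q x t + 0"
      by (intro LIMSEQ_le_const) auto
    then show ?thesis
      using csublinearD(2)[OF Q, of u "x - u" t] Q_norm[of "x - u" t] x(2) by simp
  qed
  have Qu: "1 \<le> Q u t"
  proof (rule field_le_epsilon)
    fix d :: real assume "0 < d"
    then show "1 \<le> Q u t + d" using key[of "d / 3"] by simp
  qed
  obtain S where S: "\<And>x. continuous_on UNIV (S x)" "\<And>t. linear (\<lambda>x. S x t)"
    "\<And>x t. S x t \<le> Q x t" "S u = Q u"
    using hahn_banach_kantorovich[OF ed Q] by blast
  have "\<bar>S x t\<bar> \<le> norm x \<and> \<bar>S x t - T x t\<bar> \<le> e * norm x" for x t
    using S(3)[of x t] S(3)[of "- x" t] Q_norm[of x t] Q_norm[of "- x" t] Q_T[of x t]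
      Q_T[of "- x" t] linear_neg[OF S(2), of x t] T_lin(4)[of x t]
    by auto
  moreover have "S u t = 1" using Qu S(4) Q_norm[of u t] u(1) by simp
  ultimately show thesis
    using that[of S u t] S(1,2) u(1,2) by blast
qed


section \<open>Complex functionals and their real parts\<close>

lemma cnj_sgn_mult: "cnj (sgn z) * z = of_real (norm z)"
proof (cases "z = 0")
  case False
  have "cnj z * z = of_real (norm z) * of_real (norm z)"
    using complex_norm_square[of z] by (simp add: power2_eq_square mult.commute)
  then show ?thesis using False by (simp add: sgn_eq)
qed simp

text \<open>Rotating \<open>x\<close> by the conjugate phase of \<open>F x\<close> preserves its
  norm and turns the value into the real number \<open>norm (F x)\<close>.\<close>

lemma norm_le_of_Re_le:
  fixes scaleX :: "complex \<Rightarrow> 'x::real_normed_vector \<Rightarrow> 'x"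
  assumes X: "normed_space_over scaleX" and F: "\<And>a x. F (scaleX a x) = a * F x"
    and le: "\<And>x. Re (F x) \<le> K * norm x"
  shows "norm (F x) \<le> K * norm x"
proof (cases "F x = 0")
  case True
  then show ?thesis using le[of x] by simp
next
  case False
  define c where "c = cnj (sgn (F x))"
  have "norm (scaleX c x) = norm x"
    using False by (simp add: normed_space_over.norm_scale[OF X] c_def norm_sgn)
  moreover have "F (scaleX c x) = of_real (norm (F x))"
    by (simp add: F c_def cnj_sgn_mult)
  ultimately show ?thesis using le[of "scaleX c x"] by simp
qed

text \<open>Operators into \<open>C(L)\<close> of norm at most \<open>1\<close>, seen as families of functionals on \<open>X\<close>.\<close>

definition contraction_family ::
  "('f::real_normed_field \<Rightarrow> 'x::real_normed_vector \<Rightarrow> 'x) \<Rightarrow>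
   ('x \<Rightarrow> 'l::topological_space \<Rightarrow> 'f) \<Rightarrow> bool" where
  "contraction_family scaleX T \<longleftrightarrow> (\<forall>x. continuous_on UNIV (T x)) \<and>
     (\<forall>x y t. T (x + y) t = T x t + T y t) \<and> (\<forall>a x t. T (scaleX a x) t = a * T x t) \<and>
     (\<forall>x t. norm (T x t) \<le> norm x)"

lemma contraction_family_of_operator:
  assumes T: "T \<in> bounded_operators scaleX scale_C" and nT: "norm T \<le> 1"
  shows "contraction_family scaleX (\<lambda>x. apply_bcontfun (blinfun_apply T x))"
proof -
  have "norm (apply_bcontfun (blinfun_apply T x) t) \<le> norm x" for x t
  proof -
    have "norm (apply_bcontfun (blinfun_apply T x) t) \<le> norm (blinfun_apply T x)"
      by (rule norm_bounded)
    also have "\<dots> \<le> norm T * norm x" by (rule norm_blinfun)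
    also have "\<dots> \<le> norm x" using nT by (simp add: mult_left_le_one_le)
    finally show ?thesis .
  qed
  then show ?thesis
    using T by (auto simp: contraction_family_def bounded_operators_def Vector_Spaces.linear_iff
        blinfun.add_right)
qed

lemma operator_of_contraction_family:
  fixes S :: "'x::real_normed_vector \<Rightarrow> 'l::topological_space \<Rightarrow> 'f::real_normed_field"
  assumes X: "normed_space_over scaleX" and S: "contraction_family scaleX S"
  obtains S' where "S' \<in> bounded_operators scaleX scale_C" "norm S' \<le> 1"
    "\<And>x t. apply_bcontfun (blinfun_apply S' x) t = S x t"
proof -
  define B where "B x = Bcontfun (S x)" for x
  have "S x \<in> bcontfun" for x
    using S unfolding bcontfun_def contraction_family_def bounded_iff by blast
  then have B: "apply_bcontfun (B x) t = S x t" for x t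
    by (simp add: B_def Bcontfun_inverse)
  have nB: "norm (B x) \<le> norm x" for x
    using S by (intro norm_bound) (auto simp: B contraction_family_def)
  have "S (r *\<^sub>R x) t = r *\<^sub>R S x t" for r x t
    using S normed_space_over.scale_of_real[OF X, of r x]
    unfolding contraction_family_def by (metis scaleR_conv_of_real)
  then have "bounded_linear B"
    using nB S
    by (intro bounded_linear_intro[of _ 1]) (auto intro!: bcontfun_eqI simp: B contraction_family_def)
  then have app: "blinfun_apply (Blinfun B) = B" by (rule bounded_linear_Blinfun_apply)
  show thesis
  proof (rule that)
    show "norm (Blinfun B) \<le> 1" using nB by (intro norm_blinfun_bound) (auto simp: app)
    show "Blinfun B \<in> bounded_operators scaleX scale_C"
      using X S normed_space_over_scale_C
      by (auto simp: bounded_operators_def Vector_Spaces.linear_iff app normed_space_over_def B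
          contraction_family_def intro!: bcontfun_eqI)
  qed (simp add: app B)
qed

text \<open>A contraction family suffices for \<open>S\<close>: a value of modulus \<open>1\<close>
  at a unit vector forces both the operator norm and the norm of the image to equal
  \<open>1\<close>.\<close>

lemma BPBp_scale_C:
  fixes scaleX :: "'f::real_normed_field \<Rightarrow> 'x::real_normed_vector \<Rightarrow> 'x"
  assumes X: "normed_space_over scaleX"
    and approx: "\<And>e (T :: 'x \<Rightarrow> 'l::topological_space \<Rightarrow> 'f) x0 t0.
      0 < e \<Longrightarrow> e < 1 \<Longrightarrow> contraction_family scaleX T \<Longrightarrow> norm x0 = 1 \<Longrightarrow>
      norm (T x0 t0) > 1 - e\<^sup>2 / 2 \<Longrightarrow>
      \<exists>S u t. contraction_family scaleX S \<and> (\<forall>x t. norm (S x t - T x t) \<le> e * norm x) \<and>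
        norm u = 1 \<and> norm (u - x0) < e \<and> norm (S u t) = 1"
  shows "BPBp scaleX (scale_C :: 'f \<Rightarrow> ('l \<Rightarrow>\<^sub>C 'f) \<Rightarrow> ('l \<Rightarrow>\<^sub>C 'f))"
  unfolding BPBp_def
proof (intro allI impI)
  fix \<epsilon> :: real assume \<epsilon>: "0 < \<epsilon> \<and> \<epsilon> < 1"
  \<comment> \<open>Halving turns the non-strict bound \<open>e\<close> on the operator distance
    into a strict bound \<open>\<epsilon>\<close>.\<close>
  define e where "e = \<epsilon> / 2"
  have e: "0 < e" "e < 1" "e < \<epsilon>" using \<epsilon> by (auto simp: e_def)
  show "\<exists>\<eta>>0. \<forall>T\<in>bounded_operators scaleX (scale_C :: 'f \<Rightarrow> ('l \<Rightarrow>\<^sub>C 'f) \<Rightarrow> _). \<forall>x0.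
      norm T = 1 \<and> norm x0 = 1 \<and> norm (blinfun_apply T x0) > 1 - \<eta> \<longrightarrow>
      (\<exists>S\<in>bounded_operators scaleX scale_C. \<exists>u0. norm S = 1 \<and> norm u0 = 1 \<and>
        norm (blinfun_apply S u0) = 1 \<and> norm (u0 - x0) < \<epsilon> \<and> norm (S - T) < \<epsilon>)"
  proof (intro exI[of _ "e\<^sup>2 / 2"] conjI ballI allI impI)
    fix T :: "'x \<Rightarrow>\<^sub>L 'l \<Rightarrow>\<^sub>C 'f" and x0
    assume T: "T \<in> bounded_operators scaleX scale_C"
      and a: "norm T = 1 \<and> norm x0 = 1 \<and> norm (blinfun_apply T x0) > 1 - e\<^sup>2 / 2"
    have "\<not> norm (blinfun_apply T x0) \<le> 1 - e\<^sup>2 / 2" using a by simp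
    then have "\<exists>t0. norm (apply_bcontfun (blinfun_apply T x0) t0) > 1 - e\<^sup>2 / 2"
      using norm_bound[of "blinfun_apply T x0" "1 - e\<^sup>2 / 2"] by (meson not_le)
    then obtain t0 where "norm (apply_bcontfun (blinfun_apply T x0) t0) > 1 - e\<^sup>2 / 2" ..
    then obtain S u t where S: "contraction_family scaleX S"
      and ST: "\<And>x t. norm (S x t - apply_bcontfun (blinfun_apply T x) t) \<le> e * norm x"
      and u: "norm u = 1" "norm (u - x0) < e" "norm (S u t) = 1"
      using approx[OF e(1,2) contraction_family_of_operator[OF T], of x0 t0] a by auto
    obtain S' where S': "S' \<in> bounded_operators scaleX scale_C" "norm S' \<le> 1"
      "\<And>x t. apply_bcontfun (blinfun_apply S' x) t = S x t"
      using operator_of_contraction_family[OF X S] by blast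
    have "1 \<le> norm (blinfun_apply S' u)"
      using norm_bounded[of "blinfun_apply S' u" t] u(3) S'(3) by simp
    moreover have "norm (blinfun_apply S' u) \<le> norm S'"
      using norm_blinfun[of S' u] u(1) by simp
    ultimately have "norm S' = 1" "norm (blinfun_apply S' u) = 1" using S'(2) by auto
    moreover have "norm (S' - T) \<le> e"
    proof (rule norm_blinfun_bound)
      fix x
      show "norm (blinfun_apply (S' - T) x) \<le> e * norm x"
        using ST by (intro norm_bound) (simp add: blinfun.diff_left S'(3))
    qed (use e in simp)
    ultimately show "\<exists>S\<in>bounded_operators scaleX scale_C. \<exists>u0. norm S = 1 \<and> norm u0 = 1 \<and>
        norm (blinfun_apply S u0) = 1 \<and> norm (u0 - x0) < \<epsilon> \<and> norm (S - T) < \<epsilon>"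
      using S'(1) u e(3) by (intro bexI[of _ S'] exI[of _ u]) auto
  qed (use e in simp)
qed

section \<open>The two scalar fields\<close>

lemma BPBp_real:
  fixes scaleX :: "real \<Rightarrow> 'x::banach \<Rightarrow> 'x"
  assumes ed: "extremally_disconnected TYPE('l::topological_space)"
    and card: "card_less_infty (density_character TYPE('x)) (baire_number TYPE('l))"
    and X: "normed_space_over scaleX"
  shows "BPBp scaleX (scale_C :: real \<Rightarrow> ('l \<Rightarrow>\<^sub>C real) \<Rightarrow> ('l \<Rightarrow>\<^sub>C real))"
proof (rule BPBp_scale_C[OF X])
  fix e and T :: "'x \<Rightarrow> 'l \<Rightarrow> real" and x0 t0
  assume e: "0 < e" "e < 1" and T: "contraction_family scaleX T" and x0: "norm x0 = 1"
    and t0: "norm (T x0 t0) > 1 - e\<^sup>2 / 2"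
  have sc: "scaleX = scaleR" using X by (simp add: normed_space_over_real_iff)
  have lin: "linear (\<lambda>x. T x t)" for t
    using T by (intro linearI) (auto simp: contraction_family_def sc)
  have cont: "continuous_on UNIV (T x)" and bound: "\<bar>T x t\<bar> \<le> norm x" for x t
    using T by (auto simp: contraction_family_def)
  \<comment> \<open>The approximation lemma needs \<open>T x0 t0\<close> itself near
    \<open>1\<close>, not its absolute value: \<open>x0\<close> is multiplied by the sign, and the
    resulting \<open>u\<close> is multiplied back.\<close>
  define s where "s = sgn (T x0 t0)"
  have "\<bar>T x0 t0\<bar> > 0" using t0 e power_le_one[of e 2] unfolding real_norm_def by linarith
  then have s: "s * s = 1" "\<bar>s\<bar> = 1" "s * T x0 t0 = \<bar>T x0 t0\<bar>"
    by (auto simp: s_def sgn_if)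
  have "norm (s *\<^sub>R x0) = 1" using s x0 by simp
  moreover have "T (s *\<^sub>R x0) t0 > 1 - e\<^sup>2 / 2"
    using t0 s linear_scale[OF lin, of s x0 t0] by simp
  ultimately obtain S u t where S: "\<And>x. continuous_on UNIV (S x)" "\<And>t. linear (\<lambda>x. S x t)"
    "\<And>x t. \<bar>S x t\<bar> \<le> norm x" "\<And>x t. \<bar>S x t - T x t\<bar> \<le> e * norm x"
    and u: "norm u = 1" "norm (u - s *\<^sub>R x0) < e" "S u t = 1"
    using real_operator_approximation[OF ed card cont lin bound e] by metis
  have "s *\<^sub>R u - x0 = s *\<^sub>R (u - s *\<^sub>R x0)" using s by (simp add: algebra_simps)
  then have "norm (s *\<^sub>R u - x0) < e" using u s by simp
  moreover have "contraction_family scaleX S"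
    using S by (auto simp: contraction_family_def sc linear_add[OF S(2)] linear_scale[OF S(2)])
  moreover have "norm (S (s *\<^sub>R u) t) = 1"
    using u s linear_scale[OF S(2), of s u t] by (simp add: abs_mult)
  moreover have "norm (s *\<^sub>R u) = 1" using s u by simp
  ultimately show "\<exists>S u t. contraction_family scaleX S \<and>
      (\<forall>x t. norm (S x t - T x t) \<le> e * norm x) \<and>
      norm u = 1 \<and> norm (u - x0) < e \<and> norm (S u t) = 1"
    using S(4) by (intro exI[of _ S] exI[of _ "s *\<^sub>R u"] exI[of _ t]) auto
qed

text \<open>The real case is applied to the real parts of \<open>T\<close>, after rotating
  \<open>x0\<close> so that the value at \<open>t0\<close> becomes its modulus; the real-linear
  \<open>R\<close> is then complexified and \<open>u\<close> rotated back.\<close>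

lemma BPBp_complex:
  fixes scaleX :: "complex \<Rightarrow> 'x::banach \<Rightarrow> 'x"
  assumes ed: "extremally_disconnected TYPE('l::topological_space)"
    and card: "card_less_infty (density_character TYPE('x)) (baire_number TYPE('l))"
    and X: "normed_space_over scaleX"
  shows "BPBp scaleX (scale_C :: complex \<Rightarrow> ('l \<Rightarrow>\<^sub>C complex) \<Rightarrow> ('l \<Rightarrow>\<^sub>C complex))"
proof (rule BPBp_scale_C[OF X])
  fix e and T :: "'x \<Rightarrow> 'l \<Rightarrow> complex" and x0 t0
  assume e: "0 < e" "e < 1" and T: "contraction_family scaleX T" and x0: "norm x0 = 1"
    and t0: "norm (T x0 t0) > 1 - e\<^sup>2 / 2"
  interpret X: normed_space_over scaleX by (rule X)
  have T_lin: "T (x + y) t = T x t + T y t" "T (scaleX a x) t = a * T x t" for x y a t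
    using T by (auto simp: contraction_family_def)
  have real_scale: "r *\<^sub>R x = scaleX (of_real r) x" for r x by (simp add: X.scale_of_real)
  define TR where "TR x t = Re (T x t)" for x t
  have TR: "continuous_on UNIV (TR x)" "linear (\<lambda>x. TR x t)" "\<bar>TR x t\<bar> \<le> norm x" for x t
  proof -
    show "continuous_on UNIV (TR x)"
      using T unfolding TR_def contraction_family_def by (auto intro!: continuous_intros)
    show "linear (\<lambda>x. TR x t)"
      by (intro linearI) (simp_all add: TR_def T_lin real_scale)
    show "\<bar>TR x t\<bar> \<le> norm x"
      using T abs_Re_le_cmod[of "T x t"] unfolding TR_def contraction_family_def
      by (meson order_trans)
  qed
  define s where "s = cnj (sgn (T x0 t0))"
  have "norm (T x0 t0) > 0" using t0 e power_le_one[of e 2] by linarith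
  then have s: "norm s = 1" "s * T x0 t0 = of_real (norm (T x0 t0))"
    by (simp_all add: s_def norm_sgn cnj_sgn_mult)
  then have s_inv: "cnj s * s = 1"
    using complex_norm_square[of s] by (simp add: mult.commute)
  have "norm (scaleX s x0) = 1" using s x0 by (simp add: X.norm_scale)
  moreover have "TR (scaleX s x0) t0 > 1 - e\<^sup>2 / 2"
    using t0 s by (simp add: TR_def T_lin)
  ultimately obtain R u t where R: "\<And>x. continuous_on UNIV (R x)" "\<And>t. linear (\<lambda>x. R x t)"
    "\<And>x t. \<bar>R x t\<bar> \<le> norm x" "\<And>x t. \<bar>R x t - TR x t\<bar> \<le> e * norm x"
    and u: "norm u = 1" "norm (u - scaleX s x0) < e" "R u t = 1"
    using real_operator_approximation[OF ed card TR e] by metis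
  \<comment> \<open>The complex-linear family with real part \<open>R\<close>, namely
    \<open>R x - \<i> R (\<i> x)\<close>. Its bounds follow from those on real parts by
    \<open>norm_le_of_Re_le\<close>.\<close>
  define S where "S x t = Complex (R x t) (- R (scaleX \<i> x) t)" for x t
  have S_add: "S (x + y) t = S x t + S y t" for x y t
    by (simp add: S_def X.scale_right_distrib linear_add[OF R(2)] complex_eq_iff)
  have S_scale: "S (scaleX a x) t = a * S x t" for a x t
  proof -
    have 1: "scaleX a x = Re a *\<^sub>R x + Im a *\<^sub>R scaleX \<i> x" for a x
      unfolding real_scale X.scale_scale X.scale_left_distrib[symmetric]
      by (simp add: complex_eq mult.commute)
    have 2: "scaleX \<i> (scaleX a x) = Re a *\<^sub>R scaleX \<i> x + (- Im a) *\<^sub>R x"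
      using 1[of "\<i> * a" x] by (simp add: X.scale_scale)
    show ?thesis
      unfolding S_def 2 unfolding 1[of a]
      by (simp add: linear_add[OF R(2)] linear_scale[OF R(2)] linear_diff[OF R(2)] complex_eq_iff)
  qed
  have S_norm: "norm (S x t) \<le> norm x" for x t
    using norm_le_of_Re_le[OF X, of "\<lambda>x. S x t" 1 x] S_scale abs_le_D1[OF R(3)]
    by (simp add: S_def)
  have ST: "norm (S x t - T x t) \<le> e * norm x" for x t
    using norm_le_of_Re_le[OF X, of "\<lambda>x. S x t - T x t" e x] S_scale T_lin abs_le_D1[OF R(4)]
    by (simp add: S_def TR_def algebra_simps)
  have "continuous_on UNIV (S x)" for x
    unfolding S_def Complex_eq by (intro continuous_intros R)
  then have "contraction_family scaleX S"
    using S_add S_scale S_norm by (auto simp: contraction_family_def)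
  moreover have "norm (S u t) = 1"
    using S_norm[of u t] u abs_Re_le_cmod[of "S u t"] by (simp add: S_def)
  then have "norm (S (scaleX (cnj s) u) t) = 1"
    using s by (simp add: S_scale norm_mult)
  moreover have "norm (scaleX (cnj s) u) = 1" using s u by (simp add: X.norm_scale)
  moreover have "norm (scaleX (cnj s) u - x0) < e"
  proof -
    have "scaleX (cnj s) u - x0 = scaleX (cnj s) (u - scaleX s x0)"
      using s_inv by (simp add: X.scale_right_diff_distrib)
    then show ?thesis using u s by (simp add: X.norm_scale)
  qed
  ultimately show "\<exists>S u t. contraction_family scaleX S \<and>
      (\<forall>x t. norm (S x t - T x t) \<le> e * norm x) \<and>
      norm u = 1 \<and> norm (u - x0) < e \<and> norm (S u t) = 1"
    using ST by blast
qed

theorem theorem2: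
  assumes "compact (UNIV :: 'l::t2_space set)"
    and "extremally_disconnected TYPE('l)"
    and "card_less_infty (density_character TYPE('x::banach)) (baire_number TYPE('l))"
  shows "(\<forall>scaleX :: real \<Rightarrow> 'x \<Rightarrow> 'x. normed_space_over scaleX \<longrightarrow>
            BPBp scaleX (scale_C :: real \<Rightarrow> ('l \<Rightarrow>\<^sub>C real) \<Rightarrow> ('l \<Rightarrow>\<^sub>C real))) \<and>
         (\<forall>scaleX :: complex \<Rightarrow> 'x \<Rightarrow> 'x. normed_space_over scaleX \<longrightarrow>
            BPBp scaleX (scale_C :: complex \<Rightarrow> ('l \<Rightarrow>\<^sub>C complex) \<Rightarrow> ('l \<Rightarrow>\<^sub>C complex)))"
  by (intro conjI allI impI BPBp_real[OF assms(2,3)] BPBp_complex[OF assms(2,3)])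

end
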